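(* Let $P$ be a polymatroid on $[n]$ with rank function $f$, and fix $t\in[n]$. Put $\alpha_t=f([n])-f([n]\setminus\{t\})$, $\beta_t=f(\{t\})$, $T_t=\{\alpha_t,\alpha_t+1,\ldots,\beta_t\}$, and for $j\in T_t$ let $\widehat P^t_j=\{(a_1,\ldots,a_{t-1},a_{t+1},\ldots,a_n)\mid (a_1,\ldots,a_n)\in P,\ a_t=j\}$, a polymatroid on $[n]\setminus\{t\}$. If $\beta_t-\alpha_t>0$, then $$\mathscr{T}_P(x,y)=x\,\mathscr{T}_{\widehat P^t_{\alpha_t}}(x,y)+y\,\mathscr{T}_{\widehat P^t_{\beta_t}}(x,y)+\sum_{j\in T_t\setminus\{\alpha_t,\beta_t\}}\mathscr{T}_{\widehat P^t_j}(x,y).$$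
   Context: For a finite totally ordered set $S$ (here subsets of $[n]$ with the natural order), a polymatroid on $S$ is a set $P=\{\mathbf a\in\mathbb{Z}^S\mid \sum_{i\in I}a_i\le f(I)\ \forall I\subset S,\ \sum_{i\in S}a_i=f(S)\}$ where $f:2^S\to\mathbb{Z}$ has $f(\emptyset)=0$ and is submodular; $f$ is its rank function, $f(I)=\max_{\mathbf a\in P}\sum_{i\in I}a_i$. Let $\mathbf e_i$ denote unit vectors. For $\mathbf a\in P$, $i\in S$ is internally active if $\mathbf a-\mathbf e_i+\mathbf e_j\notin P$ for all $j\in S$ with $j<i$, and externally active if $\mathbf a+\mathbf e_i-\mathbf e_j\notin P$ for all $j\in S$ with $j<i$; let $\mathrm{Int}(\mathbf a)$, $\mathrm{Ext}(\mathbf a)$ be the sets of such indices. The polymatroid Tutte polynomial is $\mathscr{T}_P(x,y)=\sum_{\mathbf a\in P}x^{|\mathrm{Int}(\mathbf a)\setminus\mathrm{Ext}(\mathbf a)|}y^{|\mathrm{Ext}(\mathbf a)\setminus\mathrm{Int}(\mathbf a)|}(x+y-1)^{|\mathrm{Int}(\mathbf a)\cap\mathrm{Ext}(\mathbf a)|}$. *)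

theory Defs
  imports "HOL-Library.FuncSet" "HOL-Computational_Algebra.Polynomial"
begin

text \<open>
  A vector in \<open>\<int>\<^sup>S\<close> is an extensional function, i.e. an element of \<open>S \<rightarrow>\<^sub>E UNIV\<close>. The values of a
  rank function on sets not contained in the ground set \<open>S\<close> are irrelevant.
\<close>

definition submodular_on :: "'a set \<Rightarrow> ('a set \<Rightarrow> int) \<Rightarrow> bool" where
  "submodular_on S f \<longleftrightarrow>
     (\<forall>A B. A \<subseteq> S \<longrightarrow> B \<subseteq> S \<longrightarrow> f (A \<union> B) + f (A \<inter> B) \<le> f A + f B)"

text \<open>
  That \<open>f I\<close> is the maximum of \<open>\<Sum>i\<in>I. a i\<close> over \<open>a \<in> P\<close> is a consequence of submodularity, not part
  of the definition.
\<close>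

definition polymatroid :: "'a set \<Rightarrow> ('a set \<Rightarrow> int) \<Rightarrow> ('a \<Rightarrow> int) set \<Rightarrow> bool" where
  "polymatroid S f P \<longleftrightarrow>
     finite S \<and> f {} = 0 \<and> submodular_on S f \<and>
     P = {a \<in> S \<rightarrow>\<^sub>E UNIV. (\<forall>I. I \<subseteq> S \<longrightarrow> (\<Sum>i\<in>I. a i) \<le> f I) \<and> (\<Sum>i\<in>S. a i) = f S}"

definition unit_vec :: "'a \<Rightarrow> 'a \<Rightarrow> int" where
  "unit_vec i = (\<lambda>k. if k = i then 1 else 0)"

text \<open>
  For \<open>a \<in> S \<rightarrow>\<^sub>E UNIV\<close> and \<open>i, j \<in> S\<close> the pointwise sums below are again extensional, because both
  unit vectors vanish outside \<open>S\<close>.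
\<close>

definition Int_act :: "'a::linorder set \<Rightarrow> ('a \<Rightarrow> int) set \<Rightarrow> ('a \<Rightarrow> int) \<Rightarrow> 'a set" where
  "Int_act S P a =
     {i \<in> S. \<forall>j\<in>S. j < i \<longrightarrow> (\<lambda>k. a k - unit_vec i k + unit_vec j k) \<notin> P}"

definition Ext_act :: "'a::linorder set \<Rightarrow> ('a \<Rightarrow> int) set \<Rightarrow> ('a \<Rightarrow> int) \<Rightarrow> 'a set" where
  "Ext_act S P a =
     {i \<in> S. \<forall>j\<in>S. j < i \<longrightarrow> (\<lambda>k. a k + unit_vec i k - unit_vec j k) \<notin> P}"

text \<open>\<open>\<int>[x, y]\<close> is rendered as \<open>(\<int>[x])[y]\<close>, with the following two indeterminates.\<close>

definition X :: "int poly poly" where "X = [:[:0, 1:]:]"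

definition Y :: "int poly poly" where "Y = [:0, 1:]"

text \<open>
  A polymatroid \<open>P\<close> with rank function \<open>f\<close> is finite, since \<open>f S - f (S - {i}) \<le> a i \<le> f {i}\<close> for
  \<open>a \<in> P\<close> and \<open>i \<in> S\<close>; so the sum below is never the default value for infinite index sets.
\<close>

definition tutte_poly :: "'a::linorder set \<Rightarrow> ('a \<Rightarrow> int) set \<Rightarrow> int poly poly" where
  "tutte_poly S P =
     (\<Sum>a\<in>P. X ^ card (Int_act S P a - Ext_act S P a) *
            Y ^ card (Ext_act S P a - Int_act S P a) *
            (X + Y - 1) ^ card (Int_act S P a \<inter> Ext_act S P a))"

definition slice :: "'a set \<Rightarrow> ('a \<Rightarrow> int) set \<Rightarrow> 'a \<Rightarrow> int \<Rightarrow> ('a \<Rightarrow> int) set" where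
  "slice S P t j = {restrict a (S - {t}) | a. a \<in> P \<and> a t = j}"

end

theory Submission
  imports Defs
begin

text \<open>
  If \<open>t\<close> is the largest element of the ground set, the other elements have the same activities in
  \<open>P\<close> and in the slices, and by the exchange property \<open>t\<close> is internally (externally) active at \<open>a\<close>
  iff \<open>a t\<close> is \<open>\<alpha>\<close> (\<open>\<beta>\<close>). This gives the recursion with the weight
  \<open>1 + (x - 1)[a t = \<alpha>] + (y - 1)[a t = \<beta>]\<close>, which is also right for \<open>\<alpha> = \<beta>\<close>.
  For any other \<open>t\<close>, expand along the largest element \<open>m\<close>, then along \<open>t\<close> by induction, exchange the
  two expansions, and collect along \<open>m\<close> again. The exchange is possible because the double slices
  are indexed by a hexagon and are constant along its two slanted edges.
\<close>

section \<open>Exchanging two weighted summations\<close>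

text \<open>The end values get the factors \<open>x\<close> and \<open>y\<close>; for
  \<open>a = b\<close> the only value gets \<open>x + y - 1\<close>, the factor of an index active
  in both senses. For \<open>a > b\<close> the corrections would survive the empty sum, hence the
  order assumptions in the next lemmas.\<close>

definition dc_sum :: "'b::comm_ring_1 \<Rightarrow> 'b \<Rightarrow> int \<Rightarrow> int \<Rightarrow> (int \<Rightarrow> 'b) \<Rightarrow> 'b" where
  "dc_sum x y a b F = sum F {a..b} + (x - 1) * F a + (y - 1) * F b"

lemma dc_sum_cong:
  assumes "a \<le> b" and "\<And>j. j \<in> {a..b} \<Longrightarrow> F j = G j"
  shows "dc_sum x y a b F = dc_sum x y a b G"
  using assms by (simp add: dc_sum_def)

lemma dc_sum_eq_weighted_sum:
  assumes "a \<le> b"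
  shows "dc_sum x y a b F =
    (\<Sum>j\<in>{a..b}. (1 + (if j = a then x - 1 else 0) + (if j = b then y - 1 else 0)) * F j)"
proof -
  have "(\<Sum>j\<in>{a..b}. (if j = c then z else 0) * F j) = z * F c" if "c \<in> {a..b}" for c z
  proof -
    have "(\<Sum>j\<in>{a..b}. (if j = c then z else 0) * F j) = (\<Sum>j\<in>{a..b}. if j = c then z * F j else 0)"
      by (intro sum.cong) auto
    then show ?thesis using that by simp
  qed
  then show ?thesis
    using assms by (simp add: dc_sum_def distrib_right sum.distrib)
qed

lemma dc_sum_less:
  assumes "a < b"
  shows "dc_sum x y a b F = x * F a + y * F b + (\<Sum>j\<in>{a..b} - {a, b}. F j)"
proof -
  have "sum F {a..b} = sum F ({a..b} - {a, b}) + sum F {a, b}"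
    by (rule sum.subset_diff) (use assms in auto)
  then show ?thesis
    using assms by (simp add: dc_sum_def algebra_simps)
qed

text \<open>Without its end \<open>(s - a2, a2)\<close>, the slanted lower edge of the hexagon has
  \<open>s - a1 - a2\<close> points, all of value \<open>c\<close>. This count is symmetric in
  \<open>a1\<close> and \<open>a2\<close>, as the exchange of summations requires.\<close>

lemma sum_lower_boundary:
  fixes T :: "int \<Rightarrow> int \<Rightarrow> 'b::comm_ring_1"
  assumes "a1 + a2 \<le> s" "s \<le> b1 + a2"
    and diag: "\<And>j. a1 \<le> j \<Longrightarrow> j \<le> s - a2 \<Longrightarrow> T j (s - j) = c"
  shows "(\<Sum>j\<in>{a1..b1}. T j (max a2 (s - j))) =
    of_int (s - a1 - a2) * c + (\<Sum>j\<in>{s - a2..b1}. T j a2)"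
proof -
  have "{a1..b1} = {a1..<s - a2} \<union> {s - a2..b1}" using assms by auto
  then have "(\<Sum>j\<in>{a1..b1}. T j (max a2 (s - j))) =
      (\<Sum>j\<in>{a1..<s - a2}. T j (max a2 (s - j))) + (\<Sum>j\<in>{s - a2..b1}. T j (max a2 (s - j)))"
    by (simp add: sum.union_disjoint ivl_disj_int)
  also have "(\<Sum>j\<in>{a1..<s - a2}. T j (max a2 (s - j))) = (\<Sum>j\<in>{a1..<s - a2}. c)"
    by (intro sum.cong) (auto simp: max_def diag)
  also have "\<dots> = of_int (s - a1 - a2) * c"
    using assms by (simp add: of_nat_nat algebra_simps)
  also have "(\<Sum>j\<in>{s - a2..b1}. T j (max a2 (s - j))) = (\<Sum>j\<in>{s - a2..b1}. T j a2)"
    by (intro sum.cong) (auto simp: max_def intro!: arg_cong[of _ _ "T _"])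
  finally show ?thesis by simp
qed

lemma sum_reflect_int:
  fixes a b :: int
  shows "(\<Sum>j\<in>{a..b}. F (- j)) = (\<Sum>j\<in>{- b..- a}. F j)"
  by (rule sum.reindex_bij_witness[where i = uminus and j = uminus]) auto

lemma sum_upper_boundary:
  fixes T :: "int \<Rightarrow> int \<Rightarrow> 'b::comm_ring_1"
  assumes "r \<le> b1 + b2" "a1 + b2 \<le> r"
    and diag: "\<And>j. r - b2 \<le> j \<Longrightarrow> j \<le> b1 \<Longrightarrow> T j (r - j) = c"
  shows "(\<Sum>j\<in>{a1..b1}. T j (min b2 (r - j))) =
    of_int (b1 + b2 - r) * c + (\<Sum>j\<in>{a1..r - b2}. T j b2)"
proof -
  \<comment> \<open>Reflection in the origin turns the upper boundary into a lower one.\<close>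
  have "(\<Sum>j\<in>{- b1..- a1}. T (- j) (- max (- b2) (- r - j))) =
    of_int (- r - - b1 - - b2) * c + (\<Sum>j\<in>{- r - - b2..- a1}. T (- j) (- (- b2)))"
  proof (rule sum_lower_boundary[where T = "\<lambda>j k. T (- j) (- k)"])
    fix j assume "- b1 \<le> j" "j \<le> - r - - b2"
    then show "T (- j) (- (- r - j)) = c" using diag[of "- j"] by (simp add: add.commute)
  qed (use assms in auto)
  moreover have "- max (- b2) (- r - j) = min b2 (r - - j)" for j by (simp add: max_def min_def)
  ultimately show ?thesis
    using sum_reflect_int[of "\<lambda>j. T j (min b2 (r - j))" "-b1" "-a1"]
      sum_reflect_int[of "\<lambda>j. T j b2" "- r - - b2" "-a1"]
    by (simp add: algebra_simps)
qed

text \<open>Both sides run over the lattice points of the box with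
  \<open>s \<le> j + k \<le> r\<close>.\<close>

lemma sum_hexagon_swap:
  fixes a1 b1 a2 b2 s r :: int
  shows "(\<Sum>j\<in>{a1..b1}. \<Sum>k\<in>{max a2 (s - j)..min b2 (r - j)}. T j k) =
    (\<Sum>k\<in>{a2..b2}. \<Sum>j\<in>{max a1 (s - k)..min b1 (r - k)}. T j k)"
proof -
  have "(\<Sum>j\<in>{a1..b1}. \<Sum>k\<in>{max a2 (s - j)..min b2 (r - j)}. T j k) =
    (\<Sum>j\<in>{a1..b1}. \<Sum>k\<in>{k \<in> {a2..b2}. s \<le> j + k \<and> j + k \<le> r}. T j k)"
    by (intro sum.cong) auto
  also have "\<dots> = (\<Sum>k\<in>{a2..b2}. \<Sum>j\<in>{j \<in> {a1..b1}. s \<le> j + k \<and> j + k \<le> r}. T j k)"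
    by (rule sum.swap_restrict) auto
  also have "\<dots> = (\<Sum>k\<in>{a2..b2}. \<Sum>j\<in>{max a1 (s - k)..min b1 (r - k)}. T j k)"
    by (intro sum.cong) auto
  finally show ?thesis .
qed

text \<open>
  Expanding the products, the two sides can differ only at the end points of the two slanted edges
  of the hexagon, where \<open>T\<close> takes equal values.
\<close>

lemma dc_sum_swap:
  fixes T :: "int \<Rightarrow> int \<Rightarrow> 'b::comm_ring_1"
  assumes s: "a1 + a2 \<le> s" "s \<le> b1 + a2" "s \<le> a1 + b2"
    and r: "r \<le> b1 + b2" "a1 + b2 \<le> r" "b1 + a2 \<le> r"
    and low: "\<And>j. a1 \<le> j \<Longrightarrow> j \<le> s - a2 \<Longrightarrow> T j (s - j) = c"
    and high: "\<And>j. r - b2 \<le> j \<Longrightarrow> j \<le> b1 \<Longrightarrow> T j (r - j) = d"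
  shows "dc_sum x y a1 b1 (\<lambda>j. dc_sum x y (max a2 (s - j)) (min b2 (r - j)) (T j)) =
    dc_sum x y a2 b2 (\<lambda>k. dc_sum x y (max a1 (s - k)) (min b1 (r - k)) (\<lambda>j. T j k))"
proof -
  have low': "T (s - k) k = c" if "a2 \<le> k" "k \<le> s - a1" for k
    using low[of "s - k"] that by simp
  have high': "T (r - k) k = d" if "r - b1 \<le> k" "k \<le> b2" for k
    using high[of "r - k"] that by simp
  \<comment> \<open>\<open>L\<close> belongs to the bottom and left edges, \<open>U\<close> to the
    top and right ones. Neither depends on the order of summation, so \<open>l1\<close>,
    \<open>l2\<close> and likewise \<open>u1\<close>, \<open>u2\<close> share their right-hand
    sides.\<close>
  define L where "L = (\<Sum>j\<in>{s - a2..b1}. T j a2) + (\<Sum>k\<in>{s - a1..b2}. T a1 k)"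
  define U where "U = (\<Sum>j\<in>{a1..r - b2}. T j b2) + (\<Sum>k\<in>{a2..r - b1}. T b1 k)"
  have l1: "(\<Sum>j\<in>{a1..b1}. T j (max a2 (s - j))) + (\<Sum>k\<in>{s - a1..b2}. T a1 k) = of_int (s - a1 - a2) * c + L"
    using sum_lower_boundary[where T = T and c = c, OF s(1,2) low] by (simp add: L_def algebra_simps)
  have l2: "(\<Sum>k\<in>{a2..b2}. T (max a1 (s - k)) k) + (\<Sum>j\<in>{s - a2..b1}. T j a2) = of_int (s - a1 - a2) * c + L"
    using sum_lower_boundary[where T = "\<lambda>k j. T j k", of a2 a1 s b2 c] s low'
    by (simp add: L_def algebra_simps)
  have u1: "(\<Sum>j\<in>{a1..b1}. T j (min b2 (r - j))) + (\<Sum>k\<in>{a2..r - b1}. T b1 k) = of_int (b1 + b2 - r) * d + U"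
    using sum_upper_boundary[where T = T and c = d, OF r(1,2) high] by (simp add: U_def algebra_simps)
  have u2: "(\<Sum>k\<in>{a2..b2}. T (min b1 (r - k)) k) + (\<Sum>j\<in>{a1..r - b2}. T j b2) = of_int (b1 + b2 - r) * d + U"
    using sum_upper_boundary[where T = "\<lambda>k j. T j k", of r b2 b1 a2 d] r high'
    by (simp add: U_def algebra_simps)
  \<comment> \<open>The corners \<open>(a1, b2)\<close> and \<open>(b1, a2)\<close> of the box lie
    in the hexagon; only the other two can be cut off. This fixes where the outermost rows and
    columns begin and end.\<close>
  have ends: "max a2 (s - a1) = s - a1" "min b2 (r - a1) = b2"
    "max a2 (s - b1) = a2" "min b2 (r - b1) = r - b1"
    "max a1 (s - a2) = s - a2" "min b1 (r - a2) = b1"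
    "max a1 (s - b2) = a1" "min b1 (r - b2) = r - b2"
    using s r by auto
  have corners: "T a1 (s - a1) = c" "T (s - a2) a2 = c" "T b1 (r - b1) = d" "T (r - b2) b2 = d"
    using low[of a1] low'[of a2] high[of b1] high'[of b2] s r by auto
  \<comment> \<open>The coefficient of \<open>x - 1\<close> collects the lower ends of all columns
    and the whole column at \<open>a1\<close>, that of \<open>y - 1\<close> the upper ends and the
    column at \<open>b1\<close>. The quadratic terms come from the ends of these two
    columns.\<close>
  have "dc_sum x y a1 b1 (\<lambda>j. dc_sum x y (max a2 (s - j)) (min b2 (r - j)) (T j)) =
      (\<Sum>j\<in>{a1..b1}. \<Sum>k\<in>{max a2 (s - j)..min b2 (r - j)}. T j k)
      + (x - 1) * ((\<Sum>j\<in>{a1..b1}. T j (max a2 (s - j))) + (\<Sum>k\<in>{s - a1..b2}. T a1 k))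
      + (y - 1) * ((\<Sum>j\<in>{a1..b1}. T j (min b2 (r - j))) + (\<Sum>k\<in>{a2..r - b1}. T b1 k))
      + (x - 1) * (x - 1) * c + (x - 1) * (y - 1) * (T a1 b2 + T b1 a2) + (y - 1) * (y - 1) * d"
    unfolding dc_sum_def ends corners sum.distrib sum_distrib_left[symmetric] by (simp add: algebra_simps)
  also have "\<dots> = (\<Sum>k\<in>{a2..b2}. \<Sum>j\<in>{max a1 (s - k)..min b1 (r - k)}. T j k)
      + (x - 1) * ((\<Sum>k\<in>{a2..b2}. T (max a1 (s - k)) k) + (\<Sum>j\<in>{s - a2..b1}. T j a2))
      + (y - 1) * ((\<Sum>k\<in>{a2..b2}. T (min b1 (r - k)) k) + (\<Sum>j\<in>{a1..r - b2}. T j b2))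
      + (x - 1) * (x - 1) * c + (x - 1) * (y - 1) * (T a1 b2 + T b1 a2) + (y - 1) * (y - 1) * d"
    unfolding l1 l2 u1 u2 sum_hexagon_swap[of T a2 s b2 r a1 b1] ..
  also have "\<dots> = dc_sum x y a2 b2 (\<lambda>k. dc_sum x y (max a1 (s - k)) (min b1 (r - k)) (\<lambda>j. T j k))"
    unfolding dc_sum_def ends corners sum.distrib sum_distrib_left[symmetric] by (simp add: algebra_simps)
  finally show ?thesis .
qed

section \<open>Rank functions of slices\<close>

definition rank_function :: "'a set \<Rightarrow> ('a set \<Rightarrow> int) \<Rightarrow> bool" where
  "rank_function S f \<longleftrightarrow> finite S \<and> f {} = 0 \<and> submodular_on S f"

definition base_set :: "'a set \<Rightarrow> ('a set \<Rightarrow> int) \<Rightarrow> ('a \<Rightarrow> int) set" where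
  "base_set S f = {a \<in> S \<rightarrow>\<^sub>E UNIV. (\<forall>I. I \<subseteq> S \<longrightarrow> sum a I \<le> f I) \<and> sum a S = f S}"

text \<open>With coordinate \<open>t\<close> fixed at \<open>j\<close>, the sum over
  \<open>I\<close> is bounded twice: by the constraint for \<open>I\<close> and by the one for
  \<open>insert t I\<close>.\<close>

definition slice_rank :: "('a set \<Rightarrow> int) \<Rightarrow> 'a \<Rightarrow> int \<Rightarrow> 'a set \<Rightarrow> int" where
  "slice_rank f t j I = min (f I) (f (insert t I) - j)"

lemma polymatroid_iff: "polymatroid S f P \<longleftrightarrow> rank_function S f \<and> P = base_set S f"
  unfolding polymatroid_def rank_function_def base_set_def by auto

lemma rank_functionD:
  assumes "rank_function S f"
  shows "finite S" "f {} = 0"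
    and "A \<subseteq> S \<Longrightarrow> B \<subseteq> S \<Longrightarrow> f (A \<union> B) + f (A \<inter> B) \<le> f A + f B"
  using assms by (auto simp: rank_function_def submodular_on_def)

text \<open>Diminishing returns: this is submodularity for \<open>A \<union> C\<close> and
  \<open>B\<close>, which meet in \<open>A\<close>.\<close>

lemma marginal_antimono:
  assumes "rank_function S f" "A \<subseteq> B" "B \<subseteq> S" "C \<subseteq> S" "C \<inter> B \<subseteq> A"
  shows "f (B \<union> C) + f A \<le> f (A \<union> C) + f B"
proof -
  have "(A \<union> C) \<union> B = B \<union> C" "(A \<union> C) \<inter> B = A" using assms by auto
  then show ?thesis using rank_functionD(3)[OF assms(1), of "A \<union> C" B] assms by auto
qed

lemma base_set_cong:
  assumes "\<And>I. I \<subseteq> S \<Longrightarrow> f I = g I"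
  shows "base_set S f = base_set S g"
  using assms by (auto simp: base_set_def)

lemma base_setD:
  assumes "a \<in> base_set S f"
  shows "I \<subseteq> S \<Longrightarrow> sum a I \<le> f I" "sum a S = f S" "a \<in> extensional S"
  using assms by (auto simp: base_set_def PiE_def)

lemma base_set_bounds:
  assumes "rank_function S f" "a \<in> base_set S f" "t \<in> S"
  shows "a t \<in> {f S - f (S - {t})..f {t}}"
proof -
  have "sum a S = a t + sum a (S - {t})"
    using rank_functionD(1)[OF assms(1)] assms(3) by (rule sum.remove)
  then show ?thesis
    using base_setD[OF assms(2)] base_setD(1)[OF assms(2), of "S - {t}"]
      base_setD(1)[OF assms(2), of "{t}"] assms(3) by force
qed

lemma finite_base_set:
  assumes "rank_function S f"
  shows "finite (base_set S f)"
proof (rule finite_subset)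
  show "base_set S f \<subseteq> (\<Pi>\<^sub>E t\<in>S. {f S - f (S - {t})..f {t}})"
  proof
    fix a assume "a \<in> base_set S f"
    then show "a \<in> (\<Pi>\<^sub>E t\<in>S. {f S - f (S - {t})..f {t}})"
      using base_set_bounds[OF assms] base_setD(3) by (simp add: PiE_iff)
  qed
  show "finite (\<Pi>\<^sub>E t\<in>S. {f S - f (S - {t})..f {t}})"
    by (intro finite_PiE rank_functionD(1)[OF assms]) auto
qed

lemma rank_bounds_le:
  assumes "rank_function S f" "t \<in> S"
  shows "f S - f (S - {t}) \<le> f {t}"
  using marginal_antimono[OF assms(1), of "{}" "S - {t}" "{t}"] rank_functionD(2)[OF assms(1)] assms(2)
  by (auto simp: insert_absorb)

lemma slice_rank_Diff:
  assumes "t \<in> S" "j \<ge> f S - f (S - {t})"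
  shows "slice_rank f t j (S - {t}) = f S - j"
  using assms by (auto simp: slice_rank_def insert_absorb)

text \<open>A minimum of two submodular functions need not be submodular. Here \<open>mixed\<close>
  settles the case where the minima at \<open>A\<close> and \<open>B\<close> are attained by
  different terms.\<close>

lemma rank_function_slice_rank:
  assumes f: "rank_function S f" and t: "t \<in> S" and j: "j \<in> {f S - f (S - {t})..f {t}}"
  shows "rank_function (S - {t}) (slice_rank f t j)"
  unfolding rank_function_def submodular_on_def
proof (intro conjI allI impI)
  show "finite (S - {t})" "slice_rank f t j {} = 0"
    using rank_functionD[OF f] j by (auto simp: slice_rank_def)
next
  fix A B assume AB: "A \<subseteq> S - {t}" "B \<subseteq> S - {t}"
  have mixed: "f (insert t (A \<union> B)) + f (A \<inter> B) \<le> f A + f (insert t B)"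
    if "A \<subseteq> S - {t}" "B \<subseteq> S - {t}" for A B
  proof -
    have "A \<inter> insert t B = A \<inter> B" "A \<union> insert t B = insert t (A \<union> B)" using that by auto
    then show ?thesis using rank_functionD(3)[OF f, of A "insert t B"] that t by auto
  qed
  have "f (insert t (A \<union> B)) + f (insert t (A \<inter> B)) \<le> f (insert t A) + f (insert t B)"
    using rank_functionD(3)[OF f, of "insert t A" "insert t B"] AB t by auto
  moreover have "f (A \<union> B) + f (A \<inter> B) \<le> f A + f B"
    using rank_functionD(3)[OF f, of A B] AB by auto
  ultimately show "slice_rank f t j (A \<union> B) + slice_rank f t j (A \<inter> B)
      \<le> slice_rank f t j A + slice_rank f t j B"
    using mixed[OF AB] mixed[OF AB(2,1)] unfolding slice_rank_def
    by (simp add: Un_commute Int_commute)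
qed

text \<open>The subsets of \<open>S\<close> pair up as \<open>I\<close> and
  \<open>insert t I\<close>, and each pair of constraints merges into one. The bound on
  \<open>j\<close> gives the reduced ground set the rank \<open>f S - j\<close>, so that the
  equations for the totals agree.\<close>

lemma fun_upd_mem_base_set_iff:
  assumes f: "rank_function S f" and t: "t \<in> S" and j: "j \<ge> f S - f (S - {t})"
    and b: "b \<in> extensional (S - {t})"
  shows "b(t := j) \<in> base_set S f \<longleftrightarrow> b \<in> base_set (S - {t}) (slice_rank f t j)"
proof -
  have fin: "finite I" if "I \<subseteq> S" for I
    using that rank_functionD(1)[OF f] finite_subset by blast
  have out: "sum (b(t := j)) I = sum b I" if "I \<subseteq> S - {t}" for I
    using that by (intro sum.cong) auto
  have ins: "sum (b(t := j)) (insert t I) = j + sum b I" if "I \<subseteq> S - {t}" for I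
  proof -
    have "finite I" "t \<notin> I" using that fin[of I] by auto
    then show ?thesis using out[OF that] by simp
  qed
  have subsets: "(\<forall>I. I \<subseteq> S \<longrightarrow> Q I) \<longleftrightarrow> (\<forall>I. I \<subseteq> S - {t} \<longrightarrow> Q I \<and> Q (insert t I))" for Q
  proof (intro iffI allI impI conjI)
    fix I assume *: "\<forall>I. I \<subseteq> S \<longrightarrow> Q I" and "I \<subseteq> S - {t}"
    then show "Q I" "Q (insert t I)" using t by (intro *[THEN spec, THEN mp]; auto)+
  next
    fix I assume *: "\<forall>I. I \<subseteq> S - {t} \<longrightarrow> Q I \<and> Q (insert t I)" and "I \<subseteq> S"
    then have "Q (I - {t}) \<and> Q (insert t (I - {t}))"
      by (intro *[THEN spec, THEN mp]) auto
    then show "Q I" by (cases "t \<in> I") (simp_all add: insert_absorb)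
  qed
  have "sum (b(t := j)) I \<le> f I \<and> sum (b(t := j)) (insert t I) \<le> f (insert t I) \<longleftrightarrow>
      sum b I \<le> slice_rank f t j I" if "I \<subseteq> S - {t}" for I
    unfolding out[OF that] ins[OF that] slice_rank_def by linarith
  then have "(\<forall>I. I \<subseteq> S \<longrightarrow> sum (b(t := j)) I \<le> f I) \<longleftrightarrow>
      (\<forall>I. I \<subseteq> S - {t} \<longrightarrow> sum b I \<le> slice_rank f t j I)"
    unfolding subsets[of "\<lambda>I. sum (b(t := j)) I \<le> f I"] by blast
  moreover have "sum (b(t := j)) S = j + sum b (S - {t})"
    using ins[of "S - {t}"] t by (simp add: insert_absorb)
  moreover have "b(t := j) \<in> extensional S"
    using b t by (auto simp: extensional_def)
  ultimately show ?thesis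
    using b by (auto simp: base_set_def PiE_def slice_rank_Diff[where f = f, OF t j])
qed

lemma slice_base_set:
  assumes f: "rank_function S f" and t: "t \<in> S" and j: "j \<ge> f S - f (S - {t})"
  shows "slice S (base_set S f) t j = base_set (S - {t}) (slice_rank f t j)"
proof (intro equalityI subsetI)
  fix b assume "b \<in> slice S (base_set S f) t j"
  then obtain a where a: "b = restrict a (S - {t})" "a \<in> base_set S f" "a t = j"
    by (auto simp: slice_def)
  have "b(t := j) = a" using a base_setD(3)[OF a(2)] by (auto simp: fun_eq_iff extensional_def)
  then show "b \<in> base_set (S - {t}) (slice_rank f t j)"
    using fun_upd_mem_base_set_iff[OF f t j, of b] a by auto
next
  fix b assume b: "b \<in> base_set (S - {t}) (slice_rank f t j)"
  then have "b(t := j) \<in> base_set S f" "restrict (b(t := j)) (S - {t}) = b"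
    using fun_upd_mem_base_set_iff[OF f t j, of b] base_setD(3)[OF b]
    by (auto simp: fun_eq_iff extensional_def)
  then show "b \<in> slice S (base_set S f) t j"
    unfolding slice_def by (intro CollectI exI[of _ "b(t := j)"]) auto
qed

section \<open>Expansion along the largest element\<close>

definition tight :: "'a set \<Rightarrow> ('a set \<Rightarrow> int) \<Rightarrow> ('a \<Rightarrow> int) \<Rightarrow> 'a set \<Rightarrow> bool" where
  "tight S f a I \<longleftrightarrow> I \<subseteq> S \<and> sum a I = f I"

text \<open>Uncrossing: sums are modular and \<open>f\<close> is submodular, so the bounds for union
  and intersection have no slack left.\<close>

lemma tight_Un_Int:
  assumes f: "rank_function S f" and a: "a \<in> base_set S f" and "tight S f a I" "tight S f a J"
  shows "tight S f a (I \<union> J)" "tight S f a (I \<inter> J)"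
proof -
  have IJ: "I \<subseteq> S" "J \<subseteq> S" "sum a I = f I" "sum a J = f J"
    using assms by (auto simp: tight_def)
  then have "finite I" "finite J" using rank_functionD(1)[OF f] finite_subset by blast+
  then have "sum a (I \<union> J) + sum a (I \<inter> J) = sum a I + sum a J"
    by (rule sum.union_inter)
  moreover have "sum a (I \<union> J) \<le> f (I \<union> J)" "sum a (I \<inter> J) \<le> f (I \<inter> J)"
    using base_setD(1)[OF a] IJ by (auto simp: le_infI1)
  ultimately show "tight S f a (I \<union> J)" "tight S f a (I \<inter> J)"
    using rank_functionD(3)[OF f IJ(1,2)] IJ by (auto simp: tight_def)
qed

lemma sum_exchange:
  assumes "finite I"
  shows "(\<Sum>k\<in>I. a k + unit_vec i k - unit_vec j k) =
    sum a I + (if i \<in> I then 1 else 0) - (if j \<in> I then 1 else 0)"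
  using assms by (simp add: unit_vec_def sum.distrib sum_subtractf)

text \<open>By integrality, an exchange that raises a sum by one can violate only a constraint that
  was an equality, and only for a set containing \<open>i\<close> but not \<open>j\<close>.\<close>

lemma exchange_or_tight:
  assumes f: "rank_function S f" and a: "a \<in> base_set S f" and ij: "i \<in> S" "j \<in> S" "i \<noteq> j"
    and no: "(\<lambda>k. a k + unit_vec i k - unit_vec j k) \<notin> base_set S f"
  obtains I where "tight S f a I" "i \<in> I" "j \<notin> I"
proof -
  have fin: "finite I" if "I \<subseteq> S" for I
    using that rank_functionD(1)[OF f] finite_subset by blast
  have "(\<lambda>k. a k + unit_vec i k - unit_vec j k) \<in> S \<rightarrow>\<^sub>E UNIV"
    using base_setD(3)[OF a] ij by (auto simp: PiE_def extensional_def unit_vec_def)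
  moreover have "(\<Sum>k\<in>S. a k + unit_vec i k - unit_vec j k) = f S"
    using base_setD(2)[OF a] ij by (simp add: sum_exchange fin)
  ultimately obtain I where I: "I \<subseteq> S" "\<not> (\<Sum>k\<in>I. a k + unit_vec i k - unit_vec j k) \<le> f I"
    using no by (auto simp: base_set_def)
  then have "i \<in> I" "j \<notin> I" "sum a I = f I"
    using base_setD(1)[OF a I(1)] by (auto simp: sum_exchange fin split: if_splits)
  with I that show thesis by (auto simp: tight_def)
qed

text \<open>Tight sets are closed under union; the induction starts at \<open>{}\<close>, tight
  since \<open>f {} = 0\<close>.\<close>

lemma ex_tight_cover:
  assumes f: "rank_function S f" and a: "a \<in> base_set S f" and "finite F"
    and "\<And>i. i \<in> F \<Longrightarrow> \<exists>I. tight S f a I \<and> i \<in> I \<and> t \<notin> I"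
  shows "\<exists>I. tight S f a I \<and> F \<subseteq> I \<and> t \<notin> I"
  using assms(3,4)
proof (induction F rule: finite_induct)
  case empty
  show ?case by (intro exI[of _ "{}"]) (auto simp: tight_def rank_functionD(2)[OF f])
next
  case (insert i F)
  then obtain I J where "tight S f a I" "F \<subseteq> I" "t \<notin> I" "tight S f a J" "i \<in> J" "t \<notin> J"
    by (metis insert_iff)
  then show ?case using tight_Un_Int(1)[OF f a, of I J] by (intro exI[of _ "I \<union> J"]) auto
qed

text \<open>The dual statement uses intersections and starts at \<open>S\<close>, tight since the
  total is fixed.\<close>

lemma ex_tight_avoid:
  assumes f: "rank_function S f" and a: "a \<in> base_set S f" and "t \<in> S" "finite F"
    and "\<And>i. i \<in> F \<Longrightarrow> \<exists>I. tight S f a I \<and> t \<in> I \<and> i \<notin> I"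
  shows "\<exists>I. tight S f a I \<and> t \<in> I \<and> F \<inter> I = {}"
  using assms(4,5)
proof (induction F rule: finite_induct)
  case empty
  show ?case using assms(3) base_setD(2)[OF a] by (intro exI[of _ S]) (auto simp: tight_def)
next
  case (insert i F)
  then obtain I J where "tight S f a I" "t \<in> I" "F \<inter> I = {}" "tight S f a J" "t \<in> J" "i \<notin> J"
    by (metis insert_iff)
  then show ?case using tight_Un_Int(2)[OF f a, of I J] by (intro exI[of _ "I \<inter> J"]) auto
qed

text \<open>All other elements lie below \<open>t\<close>, so activity gives for each of them a
  tight set containing it but not \<open>t\<close>. Their union makes \<open>S - {t}\<close> tight,
  so \<open>a t\<close> is minimal. Conversely, a minimal coordinate cannot be lowered.\<close>

lemma Max_mem_Int_act_iff:
  fixes S :: "'a::linorder set"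
  assumes f: "rank_function S f" and a: "a \<in> base_set S f" and t: "t \<in> S" "\<And>i. i \<in> S \<Longrightarrow> i \<le> t"
  shows "t \<in> Int_act S (base_set S f) a \<longleftrightarrow> a t = f S - f (S - {t})"
proof
  assume act: "t \<in> Int_act S (base_set S f) a"
  have "\<exists>I. tight S f a I \<and> i \<in> I \<and> t \<notin> I" if i: "i \<in> S - {t}" for i
  proof -
    have "i < t" using i t by force
    then have "(\<lambda>k. a k + unit_vec i k - unit_vec t k) \<notin> base_set S f"
      using act i by (auto simp: Int_act_def algebra_simps)
    then show ?thesis using exchange_or_tight[OF f a] i t by blast
  qed
  then obtain I where I: "tight S f a I" "S - {t} \<subseteq> I" "t \<notin> I"
    using ex_tight_cover[OF f a, of "S - {t}" t] rank_functionD(1)[OF f] by auto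
  then have "I = S - {t}" by (auto simp: tight_def)
  then have "sum a (S - {t}) = f (S - {t})" using I by (simp add: tight_def)
  then show "a t = f S - f (S - {t})"
    using base_setD(2)[OF a] sum.remove[OF rank_functionD(1)[OF f] t(1), of a] by simp
next
  assume at: "a t = f S - f (S - {t})"
  have "(\<lambda>k. a k - unit_vec t k + unit_vec j k) \<notin> base_set S f" if "j < t" for j
    using base_set_bounds[OF f _ t(1), of "\<lambda>k. a k - unit_vec t k + unit_vec j k"] at that
    by (auto simp: unit_vec_def split: if_splits)
  then show "t \<in> Int_act S (base_set S f) a" using t by (auto simp: Int_act_def)
qed

text \<open>Dually, the tight sets that contain \<open>t\<close> and avoid one other element each
  can be intersected down to \<open>{t}\<close>.\<close>

lemma Max_mem_Ext_act_iff:
  fixes S :: "'a::linorder set"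
  assumes f: "rank_function S f" and a: "a \<in> base_set S f" and t: "t \<in> S" "\<And>i. i \<in> S \<Longrightarrow> i \<le> t"
  shows "t \<in> Ext_act S (base_set S f) a \<longleftrightarrow> a t = f {t}"
proof
  assume act: "t \<in> Ext_act S (base_set S f) a"
  have "\<exists>I. tight S f a I \<and> t \<in> I \<and> i \<notin> I" if i: "i \<in> S - {t}" for i
  proof -
    have "i < t" using i t by force
    then have "(\<lambda>k. a k + unit_vec t k - unit_vec i k) \<notin> base_set S f"
      using act i by (auto simp: Ext_act_def)
    then show ?thesis using exchange_or_tight[OF f a] i t by blast
  qed
  then obtain I where I: "tight S f a I" "t \<in> I" "(S - {t}) \<inter> I = {}"
    using ex_tight_avoid[OF f a t(1), of "S - {t}"] rank_functionD(1)[OF f] by auto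
  then have "I = {t}" by (auto simp: tight_def)
  then show "a t = f {t}" using I by (simp add: tight_def)
next
  assume at: "a t = f {t}"
  have "(\<lambda>k. a k + unit_vec t k - unit_vec j k) \<notin> base_set S f" if "j < t" for j
    using base_set_bounds[OF f _ t(1), of "\<lambda>k. a k + unit_vec t k - unit_vec j k"] at that
    by (auto simp: unit_vec_def split: if_splits)
  then show "t \<in> Ext_act S (base_set S f) a" using t by (auto simp: Ext_act_def)
qed

text \<open>The exchanges that test an element other than \<open>t\<close> involve only smaller
  partners, never the maximum \<open>t\<close>. They keep the coordinate at \<open>t\<close> and so
  stay in the slice.\<close>

lemma act_fun_upd:
  fixes S :: "'a::linorder set"
  assumes f: "rank_function S f" and t: "t \<in> S" "\<And>i. i \<in> S \<Longrightarrow> i \<le> t"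
    and j: "j \<ge> f S - f (S - {t})" and b: "b \<in> base_set (S - {t}) (slice_rank f t j)"
  shows "Int_act S (base_set S f) (b(t := j)) - {t} =
      Int_act (S - {t}) (base_set (S - {t}) (slice_rank f t j)) b"
    and "Ext_act S (base_set S f) (b(t := j)) - {t} =
      Ext_act (S - {t}) (base_set (S - {t}) (slice_rank f t j)) b"
proof -
  have key: "(\<lambda>k. (b(t := j)) k + unit_vec i k - unit_vec i' k) \<in> base_set S f \<longleftrightarrow>
      (\<lambda>k. b k + unit_vec i k - unit_vec i' k) \<in> base_set (S - {t}) (slice_rank f t j)"
    if "i \<in> S - {t}" "i' \<in> S - {t}" for i i'
  proof -
    have "(\<lambda>k. (b(t := j)) k + unit_vec i k - unit_vec i' k) =
        (\<lambda>k. b k + unit_vec i k - unit_vec i' k)(t := j)"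
      using that by (auto simp: fun_eq_iff unit_vec_def)
    moreover have "(\<lambda>k. b k + unit_vec i k - unit_vec i' k) \<in> extensional (S - {t})"
      using that base_setD(3)[OF b] by (auto simp: extensional_def unit_vec_def)
    ultimately show ?thesis using fun_upd_mem_base_set_iff[OF f t(1) j] by simp
  qed
  have key': "(\<lambda>k. (b(t := j)) k - unit_vec i' k + unit_vec i k) \<in> base_set S f \<longleftrightarrow>
      (\<lambda>k. b k - unit_vec i' k + unit_vec i k) \<in> base_set (S - {t}) (slice_rank f t j)"
    if "i \<in> S - {t}" "i' \<in> S - {t}" for i i'
    using key[OF that] by (simp only: diff_add_eq)
  have less: "k \<in> S - {t} \<longleftrightarrow> k \<in> S" if "i \<in> S" "k < i" for i k
    using t(2)[OF that(1)] that by auto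
  show "Int_act S (base_set S f) (b(t := j)) - {t} =
      Int_act (S - {t}) (base_set (S - {t}) (slice_rank f t j)) b"
    using key' less unfolding Int_act_def by blast
  show "Ext_act S (base_set S f) (b(t := j)) - {t} =
      Ext_act (S - {t}) (base_set (S - {t}) (slice_rank f t j)) b"
    using key less unfolding Ext_act_def by blast
qed

definition act_weight :: "'b::comm_ring_1 \<Rightarrow> 'b \<Rightarrow> 'a set \<Rightarrow> 'a set \<Rightarrow> 'b" where
  "act_weight x y I E = x ^ card (I - E) * y ^ card (E - I) * (x + y - 1) ^ card (I \<inter> E)"

text \<open>Removing \<open>t\<close> splits off \<open>x\<close>, \<open>y\<close>,
  \<open>x + y - 1\<close> or \<open>1\<close>, and the bracket gives all four cases at
  once.\<close>

lemma act_weight_remove: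
  fixes x y :: "'b::comm_ring_1"
  assumes "finite I" "finite E"
  shows "act_weight x y I E =
    (1 + (if t \<in> I then x - 1 else 0) + (if t \<in> E then y - 1 else 0)) * act_weight x y (I - {t}) (E - {t})"
proof -
  have fin: "finite (I - E)" "finite (E - I)" "finite (I \<inter> E)" using assms by auto
  have sets: "(I - {t}) - (E - {t}) = (I - E) - {t}" "(E - {t}) - (I - {t}) = (E - I) - {t}"
    "(I - {t}) \<inter> (E - {t}) = (I \<inter> E) - {t}" by auto
  have pow: "z ^ card A = (if t \<in> A then z else 1) * z ^ card (A - {t})" if "finite A" for z :: 'b and A
    using card.remove[OF that, of t] by (cases "t \<in> A") (simp_all only: power_Suc if_True if_False
      mult_1 Diff_insert0 Diff_empty not_False_eq_True)
  show ?thesis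
    unfolding act_weight_def sets
    by (subst (1 2 3) pow) (use fin in \<open>auto simp: algebra_simps\<close>)
qed

lemma tutte_poly_eq_act_weight:
  "tutte_poly S P = (\<Sum>a\<in>P. act_weight X Y (Int_act S P a) (Ext_act S P a))"
  by (simp add: tutte_poly_def act_weight_def)

lemma tutte_poly_expand_Max:
  fixes S :: "'a::linorder set"
  assumes f: "rank_function S f" and t: "t \<in> S" "\<And>i. i \<in> S \<Longrightarrow> i \<le> t"
  shows "tutte_poly S (base_set S f) = dc_sum X Y (f S - f (S - {t})) (f {t})
    (\<lambda>j. tutte_poly (S - {t}) (base_set (S - {t}) (slice_rank f t j)))"
proof -
  let ?\<alpha> = "f S - f (S - {t})" and ?\<beta> = "f {t}"
  let ?B = "base_set S f" and ?B' = "\<lambda>j. base_set (S - {t}) (slice_rank f t j)"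
  let ?w = "\<lambda>j. 1 + (if j = ?\<alpha> then X - 1 else 0) + (if j = ?\<beta> then Y - 1 else 0)"
  let ?term = "\<lambda>S P a. act_weight X Y (Int_act S P a) (Ext_act S P a)"
  note upd = fun_upd_mem_base_set_iff[OF f t(1)]
  have finS: "finite S" using rank_functionD(1)[OF f] .
  have fin': "finite (?B' j)" if "j \<in> {?\<alpha>..?\<beta>}" for j
    using finite_base_set[OF rank_function_slice_rank[OF f t(1) that]] .
  \<comment> \<open>Each point is encoded by its coordinate at \<open>t\<close> and its restriction
    to the other elements.\<close>
  have "tutte_poly S ?B = (\<Sum>(j, b)\<in>(SIGMA j:{?\<alpha>..?\<beta>}. ?B' j). ?term S ?B (b(t := j)))"
    unfolding tutte_poly_eq_act_weight
  proof (rule sum.reindex_bij_witness[where i = "\<lambda>(j, b). b(t := j)" and j = "\<lambda>a. (a t, restrict a (S - {t}))"])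
    fix a assume a: "a \<in> ?B"
    have upd_a: "(restrict a (S - {t}))(t := a t) = a"
      using base_setD(3)[OF a] by (auto simp: fun_eq_iff extensional_def)
    then show "(case (a t, restrict a (S - {t})) of (j, b) \<Rightarrow> b(t := j)) = a" by simp
    show "(a t, restrict a (S - {t})) \<in> (SIGMA j:{?\<alpha>..?\<beta>}. ?B' j)"
      using base_set_bounds[OF f a t(1)] upd[of "a t" "restrict a (S - {t})"] upd_a a by auto
    show "(case (a t, restrict a (S - {t})) of (j, b) \<Rightarrow> ?term S ?B (b(t := j))) = ?term S ?B a"
      using upd_a by simp
  next
    fix p assume "p \<in> (SIGMA j:{?\<alpha>..?\<beta>}. ?B' j)"
    then obtain j b where p: "p = (j, b)" "j \<in> {?\<alpha>..?\<beta>}" "b \<in> ?B' j" by auto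
    have "restrict (b(t := j)) (S - {t}) = b"
      using base_setD(3)[OF p(3)] by (auto simp: fun_eq_iff extensional_def)
    then show "((case p of (j, b) \<Rightarrow> b(t := j)) t, restrict (case p of (j, b) \<Rightarrow> b(t := j)) (S - {t})) = p"
      by (simp add: p)
    show "(case p of (j, b) \<Rightarrow> b(t := j)) \<in> ?B"
      using upd[of j b] p base_setD(3)[OF p(3)] by auto
  qed
  also have "\<dots> = (\<Sum>(j, b)\<in>(SIGMA j:{?\<alpha>..?\<beta>}. ?B' j). ?w j * ?term (S - {t}) (?B' j) b)"
  proof (rule sum.cong[OF refl], clarify)
    fix j b assume j: "j \<in> {?\<alpha>..?\<beta>}" and b: "b \<in> ?B' j"
    let ?a = "b(t := j)"
    have a: "?a \<in> ?B" using upd[of j b] j b base_setD(3)[OF b] by auto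
    have "finite (Int_act S ?B ?a)" "finite (Ext_act S ?B ?a)"
      using finS by (auto simp: Int_act_def Ext_act_def)
    then show "?term S ?B ?a = ?w j * ?term (S - {t}) (?B' j) b"
      using act_weight_remove[of "Int_act S ?B ?a" "Ext_act S ?B ?a" X Y t] j
        act_fun_upd[OF f t _ b] Max_mem_Int_act_iff[OF f a t] Max_mem_Ext_act_iff[OF f a t] by simp
  qed
  also have "\<dots> = (\<Sum>j\<in>{?\<alpha>..?\<beta>}. ?w j * tutte_poly (S - {t}) (?B' j))"
    unfolding tutte_poly_eq_act_weight sum_distrib_left by (rule sum.Sigma[symmetric]) (use fin' in auto)
  finally show ?thesis
    by (simp only: dc_sum_eq_weighted_sum[OF rank_bounds_le[OF f t(1)]])
qed

section \<open>Expansion along an arbitrary element\<close>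

text \<open>Either side is the minimum of four terms: \<open>I\<close> with or without
  \<open>m\<close> and \<open>t\<close>, less the values of the coordinates added.\<close>

lemma slice_rank_commute:
  "slice_rank (slice_rank f m j) t k = slice_rank (slice_rank f t k) m j"
  by (auto simp: slice_rank_def fun_eq_iff insert_commute min_def)

text \<open>
  The coordinates \<open>(a m, a t)\<close> of the points of \<open>P\<close> fill a hexagon. The minimum \<open>s\<close> and the
  maximum \<open>r\<close> of \<open>a m + a t\<close> cut out faces of \<open>P\<close> that are products, so that the double slices
  do not change along the two slanted edges.
\<close>

lemma slice_rank_lower_edge:
  assumes f: "rank_function S f" and mt: "m \<in> S" "t \<in> S" "m \<noteq> t"
    and jk: "j + k = f S - f (S - {m, t})" "f S - f (S - {m}) \<le> j" "f S - f (S - {t}) \<le> k"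
    and I: "I \<subseteq> S - {m, t}"
  shows "slice_rank (slice_rank f m j) t k I = f I"
proof -
  have "insert m (S - {m, t}) = S - {t}" "insert t (S - {m, t}) = S - {m}"
    "insert m (insert t (S - {m, t})) = S"
    using mt by auto
  \<comment> \<open>Marginal values over \<open>I\<close> are at least those over
    \<open>S - {m, t}\<close>, so \<open>f I\<close> is the least of the four terms.\<close>
  then have "f (S - {t}) + f I \<le> f (insert m I) + f (S - {m, t})"
    "f (S - {m}) + f I \<le> f (insert t I) + f (S - {m, t})"
    "f S + f I \<le> f (insert m (insert t I)) + f (S - {m, t})"
    using marginal_antimono[OF f I, of "{m}"] marginal_antimono[OF f I, of "{t}"]
      marginal_antimono[OF f I, of "{m, t}"] mt by auto
  then show ?thesis using jk by (simp add: slice_rank_def)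
qed

text \<open>Here the term with both \<open>m\<close> and \<open>t\<close> is the least. The result
  is the contraction of \<open>f\<close> by \<open>{m, t}\<close>, which depends on \<open>j\<close>
  and \<open>k\<close> only through their sum.\<close>

lemma slice_rank_upper_edge:
  assumes f: "rank_function S f" and mt: "m \<in> S" "t \<in> S" "m \<noteq> t"
    and jk: "j + k = f {m, t}" "j \<le> f {m}" "k \<le> f {t}" and I: "I \<subseteq> S - {m, t}"
  shows "slice_rank (slice_rank f m j) t k I = f (insert m (insert t I)) - f {m, t}"
proof -
  have "f (insert m (insert t I)) + f {} \<le> f {m, t} + f I"
    using marginal_antimono[OF f, of "{}" I "{m, t}"] I mt by auto
  moreover have "f (insert m (insert t I)) + f {m} \<le> f {m, t} + f (insert m I)"
    using marginal_antimono[OF f, of "{m}" "insert m I" "{t}"] I mt by (auto simp: insert_commute)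
  moreover have "f (insert m (insert t I)) + f {t} \<le> f {m, t} + f (insert t I)"
    using marginal_antimono[OF f, of "{t}" "insert t I" "{m}"] I mt by auto
  ultimately show ?thesis
    using jk rank_functionD(2)[OF f] by (simp add: slice_rank_def)
qed

text \<open>These are the end points of the section of the hexagon at
  \<open>a m = j\<close>.\<close>

lemma slice_rank_bounds:
  assumes "m \<in> S" "t \<in> S" "m \<noteq> t" and "f S - f (S - {m}) \<le> j"
  shows "slice_rank f m j (S - {m}) - slice_rank f m j (S - {m} - {t}) =
      max (f S - f (S - {t})) (f S - f (S - {m, t}) - j)"
    and "slice_rank f m j {t} = min (f {t}) (f {m, t} - j)"
proof -
  have "insert m (S - {m} - {t}) = S - {t}" "S - {m} - {t} = S - {m, t}" using assms by auto
  then show "slice_rank f m j (S - {m}) - slice_rank f m j (S - {m} - {t}) =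
      max (f S - f (S - {t})) (f S - f (S - {m, t}) - j)"
    unfolding slice_rank_Diff[where f = f, OF assms(1,4)] by (simp add: slice_rank_def)
  show "slice_rank f m j {t} = min (f {t}) (f {m, t} - j)" by (simp add: slice_rank_def)
qed

text \<open>The form with \<open>dc_sum\<close> also covers a single value of \<open>a t\<close>;
  the induction needs this, since a section of the hexagon can be one point.\<close>

lemma tutte_poly_expand:
  fixes S :: "'a::linorder set"
  assumes "rank_function S f" "t \<in> S"
  shows "tutte_poly S (base_set S f) = dc_sum X Y (f S - f (S - {t})) (f {t})
    (\<lambda>j. tutte_poly (S - {t}) (base_set (S - {t}) (slice_rank f t j)))"
  using assms
proof (induction "card S" arbitrary: S f rule: less_induct)
  case less
  note f = less.prems(1) and t = less.prems(2)
  have finS: "finite S" using rank_functionD(1)[OF f] .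
  define m where "m = Max S"
  have m: "m \<in> S" "\<And>i. i \<in> S \<Longrightarrow> i \<le> m" using Max_in[OF finS] Max_ge[OF finS] t by (auto simp only: m_def)
  show ?case
  proof (cases "t = m")
    case True
    then show ?thesis using tutte_poly_expand_Max[OF f] m by simp
  next
    case False
    then have mt: "m \<noteq> t" by simp
    let ?am = "f S - f (S - {m})" and ?bm = "f {m}" and ?at = "f S - f (S - {t})" and ?bt = "f {t}"
    let ?s = "f S - f (S - {m, t})" and ?r = "f {m, t}"
    let ?R = "S - {m, t}"
    have R: "S - {m} - {t} = ?R" "S - {t} - {m} = ?R" by auto
    define T where "T j k = tutte_poly ?R (base_set ?R (slice_rank (slice_rank f m j) t k))" for j k
    have un: "S - {t} \<union> {t} = S" "S - {m} \<union> {m} = S" "?R \<union> {t} = S - {m}" "?R \<union> {m} = S - {t}"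
      "{} \<union> {m} = {m}" "{} \<union> {t} = {t}" "{t} \<union> {m} = {m, t}" "{m} \<union> {t} = {m, t}"
      using m(1) t mt by auto
    \<comment> \<open>Each of these six comparisons of marginal values rearranges to one inequality
      of \<open>hex\<close>.\<close>
    have "f S + f ?R \<le> f (S - {m}) + f (S - {t})"
      using marginal_antimono[OF f, of ?R "S - {t}" "{t}", unfolded un] m(1) t mt by blast
    moreover have "f (S - {t}) + f {} \<le> f {m} + f ?R"
      using marginal_antimono[OF f, of "{}" ?R "{m}", unfolded un] m(1) by blast
    moreover have "f (S - {m}) + f {} \<le> f {t} + f ?R"
      using marginal_antimono[OF f, of "{}" ?R "{t}", unfolded un] t by blast
    moreover have "f {m, t} + f {} \<le> f {m} + f {t}"
      using marginal_antimono[OF f, of "{}" "{t}" "{m}", unfolded un] m(1) t mt by blast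
    moreover have "f S + f {t} \<le> f {m, t} + f (S - {m})"
      using marginal_antimono[OF f, of "{t}" "S - {m}" "{m}", unfolded un] m(1) t mt by blast
    moreover have "f S + f {m} \<le> f {m, t} + f (S - {t})"
      using marginal_antimono[OF f, of "{m}" "S - {t}" "{t}", unfolded un] m(1) t mt by blast
    ultimately have hex: "?am + ?at \<le> ?s" "?s \<le> ?bm + ?at" "?s \<le> ?am + ?bt"
      "?r \<le> ?bm + ?bt" "?am + ?bt \<le> ?r" "?bm + ?at \<le> ?r"
      using rank_functionD(2)[OF f] by linarith+
    have low: "T j (?s - j) = tutte_poly ?R (base_set ?R f)" if "?am \<le> j" "j \<le> ?s - ?at" for j
    proof -
      have "base_set ?R (slice_rank (slice_rank f m j) t (?s - j)) = base_set ?R f"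
        by (intro base_set_cong slice_rank_lower_edge[OF f m(1) t mt]) (use that in auto)
      then show ?thesis by (simp add: T_def)
    qed
    have high: "T j (?r - j) = tutte_poly ?R (base_set ?R (\<lambda>I. f (insert m (insert t I)) - ?r))"
      if "?r - ?bt \<le> j" "j \<le> ?bm" for j
    proof -
      have "base_set ?R (slice_rank (slice_rank f m j) t (?r - j)) =
          base_set ?R (\<lambda>I. f (insert m (insert t I)) - ?r)"
        by (intro base_set_cong slice_rank_upper_edge[OF f m(1) t mt]) (use that in auto)
      then show ?thesis by (simp add: T_def)
    qed
    have "tutte_poly S (base_set S f) = dc_sum X Y ?am ?bm
        (\<lambda>j. tutte_poly (S - {m}) (base_set (S - {m}) (slice_rank f m j)))"
      by (rule tutte_poly_expand_Max[OF f m])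
    also have "\<dots> = dc_sum X Y ?am ?bm (\<lambda>j. dc_sum X Y (max ?at (?s - j)) (min ?bt (?r - j)) (T j))"
    proof (rule dc_sum_cong[OF rank_bounds_le[OF f m(1)]])
      fix j assume j: "j \<in> {?am..?bm}"
      have "card (S - {m}) < card S" using finS m(1) by (intro psubset_card_mono) auto
      then show "tutte_poly (S - {m}) (base_set (S - {m}) (slice_rank f m j)) =
          dc_sum X Y (max ?at (?s - j)) (min ?bt (?r - j)) (T j)"
        using less.hyps[OF _ rank_function_slice_rank[OF f m(1) j]] t mt j
          slice_rank_bounds[of m S t f j] m(1)
        by (simp add: R T_def[abs_def])
    qed
    also have "\<dots> = dc_sum X Y ?at ?bt (\<lambda>k. dc_sum X Y (max ?am (?s - k)) (min ?bm (?r - k)) (\<lambda>j. T j k))"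
      by (rule dc_sum_swap[where T = T, OF hex low high])
    also have "\<dots> = dc_sum X Y ?at ?bt (\<lambda>k. tutte_poly (S - {t}) (base_set (S - {t}) (slice_rank f t k)))"
    proof (rule dc_sum_cong[OF rank_bounds_le[OF f t]])
      fix k assume k: "k \<in> {?at..?bt}"
      \<comment> \<open>After slicing at \<open>t\<close>, \<open>m\<close> is still the largest
        element, so the expansion along the maximum applies and is read backwards.\<close>
      show "dc_sum X Y (max ?am (?s - k)) (min ?bm (?r - k)) (\<lambda>j. T j k) =
          tutte_poly (S - {t}) (base_set (S - {t}) (slice_rank f t k))"
        using tutte_poly_expand_Max[OF rank_function_slice_rank[OF f t k], of m] m mt k
          slice_rank_bounds[of t S m f k] t
        by (simp add: R T_def[abs_def] slice_rank_commute[of f m _ t k] insert_commute)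
    qed
    finally show ?thesis .
  qed
qed

theorem theorem3p5:
  fixes n t :: nat and f :: "nat set \<Rightarrow> int" and P :: "(nat \<Rightarrow> int) set"
    and \<alpha> \<beta> :: int and Phat :: "int \<Rightarrow> (nat \<Rightarrow> int) set"
  assumes "polymatroid {1..n} f P"
    and "t \<in> {1..n}"
    and "\<alpha> = f {1..n} - f ({1..n} - {t})"
    and "\<beta> = f {t}"
    and "\<And>j. Phat j = slice {1..n} P t j"
  shows "(\<forall>j\<in>{\<alpha>..\<beta>}. \<exists>g. polymatroid ({1..n} - {t}) g (Phat j)) \<and>
    (\<beta> - \<alpha> > 0 \<longrightarrow>
      tutte_poly {1..n} P =
        X * tutte_poly ({1..n} - {t}) (Phat \<alpha>) +
        Y * tutte_poly ({1..n} - {t}) (Phat \<beta>) +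
        (\<Sum>j\<in>{\<alpha>..\<beta>} - {\<alpha>, \<beta>}. tutte_poly ({1..n} - {t}) (Phat j)))"
proof -
  let ?S = "{1..n}"
  have f: "rank_function ?S f" and P: "P = base_set ?S f"
    using assms(1) by (auto simp: polymatroid_iff)
  have Phat: "Phat j = base_set (?S - {t}) (slice_rank f t j)" if "j \<in> {\<alpha>..\<beta>}" for j
    using slice_base_set[OF f assms(2)] that by (simp add: assms(3-5) P)
  show ?thesis
  proof (intro conjI ballI impI)
    fix j assume "j \<in> {\<alpha>..\<beta>}"
    then show "\<exists>g. polymatroid (?S - {t}) g (Phat j)"
      using rank_function_slice_rank[OF f assms(2)] Phat by (auto simp: polymatroid_iff assms(3,4))
  next
    assume "\<beta> - \<alpha> > 0"
    then have less: "\<alpha> < \<beta>" by simp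
    have "tutte_poly ?S P = dc_sum X Y \<alpha> \<beta>
        (\<lambda>j. tutte_poly (?S - {t}) (base_set (?S - {t}) (slice_rank f t j)))"
      using tutte_poly_expand[OF f assms(2)] by (simp only: P assms(3,4))
    also have "\<dots> = dc_sum X Y \<alpha> \<beta> (\<lambda>j. tutte_poly (?S - {t}) (Phat j))"
      using less by (intro dc_sum_cong) (simp_all add: Phat)
    finally show "tutte_poly ?S P =
        X * tutte_poly (?S - {t}) (Phat \<alpha>) +
        Y * tutte_poly (?S - {t}) (Phat \<beta>) +
        (\<Sum>j\<in>{\<alpha>..\<beta>} - {\<alpha>, \<beta>}. tutte_poly (?S - {t}) (Phat j))"
      by (simp only: dc_sum_less[OF less])
  qed
qed

end
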